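(* Let $p>2$, and let $f_p:\mathbb{R}\to\mathbb{R}$ and $g_p:[0,1]\to\mathbb{R}$ be the functions defined in the context. Then: (i) $f_p$ is quasiconcave on $[-1,1]$ and is uniquely maximized over $[-1,1]$ by a point $u_0$ satisfying $$u_0 := \operatorname*{argmax}_{u\in[-1,1]} f_p(u)\in(-1,0).$$ Furthermore, $u_0$ is the unique stationary point of $f_p$ over $(-1,0)$, and $-u_0$ is the unique root of $g_p$ over $[0,1]$. (ii) If $q>p$, then $f_q(u)>f_p(u)$ for all $u\in(-1,0)$.
   Context: For $p>1$, the function $f_p:\mathbb{R}\to\mathbb{R}$ is defined by $$f_p(u):=\frac{|u|^p-pu+(p-1)}{(p-1)|u|^p-p\operatorname{sgn}(u)|u|^{p-1}+1}\quad\text{if }u\neq1,\qquad f_p(1):=1$$ (the denominator is positive for every $u\neq 1$). For $p>2$, the function $g_p:[0,1]\to\mathbb{R}$ is defined by $$g_p(u):=u^{2(p-1)}-(p-1)^2u^p-2p(p-2)u^{p-1}-(p-1)^2u^{p-2}+1.$$ A stationary point is a point at which the derivative vanishes. Here $f_q$ denotes the same function with $p$ replaced by $q$. *)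

theory Defs
  imports "HOL-Analysis.Analysis"
begin

definition fp :: "real \<Rightarrow> real \<Rightarrow> real" where
  "fp p u =
     (if u = 1 then 1
      else (\<bar>u\<bar> powr p - p * u + (p - 1)) /
           ((p - 1) * \<bar>u\<bar> powr p - p * sgn u * \<bar>u\<bar> powr (p - 1) + 1))"

text \<open>Only meaningful for \<open>p > 2\<close> and \<open>u\<close> in \<open>{0..1}\<close>; all exponents are then
  positive, so \<open>0 powr a = 0\<close> agrees with the usual value at \<open>u = 0\<close>.\<close>
definition gp :: "real \<Rightarrow> real \<Rightarrow> real" where
  "gp p u = u powr (2 * (p - 1)) - (p - 1)\<^sup>2 * u powr p
            - 2 * p * (p - 2) * u powr (p - 1) - (p - 1)\<^sup>2 * u powr (p - 2) + 1"

definition quasiconcave_on :: "'a::real_vector set \<Rightarrow> ('a \<Rightarrow> real) \<Rightarrow> bool" where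
  "quasiconcave_on S f \<longleftrightarrow> convex S \<and>
     (\<forall>x\<in>S. \<forall>y\<in>S. \<forall>t\<in>{0..1}. f ((1 - t) *\<^sub>R x + t *\<^sub>R y) \<ge> min (f x) (f y))"

definition stationary_point :: "(real \<Rightarrow> real) \<Rightarrow> real \<Rightarrow> bool" where
  "stationary_point f u \<longleftrightarrow> (f has_real_derivative 0) (at u)"

end

theory Submission imports Defs begin

text \<open>
  Put \<open>u = s * v\<close> with \<open>v \<ge> 0\<close> and \<open>s = 1\<close> or \<open>s = -1\<close>, so that both halves of the interval
  are treated by one formula. The quotient rule then yields, as \<open>s\<^sup>2 = 1\<close>, that the derivative of
  \<open>fp p (s * v)\<close> in \<open>v > 0\<close> (away from the point \<open>s * v = 1\<close>) has the sign of
  \<open>- s * ((1 - s * v powr (p - 1))\<^sup>2 - (p - 1)\<^sup>2 * v powr (p - 2) * (1 - s * v)\<^sup>2)\<close>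
  (lemma \<open>ratio_has_derivative\<close>).

  For \<open>s = 1\<close>, the difference of squares is positive: with \<open>v = exp (- 2 * t)\<close>, this says
  \<open>sinh ((p - 1) * t) > (p - 1) * sinh t\<close>. So \<open>fp p\<close> decreases on \<open>[0,1)\<close>.
  The value \<open>1\<close> at the point \<open>1\<close> continues this decrease because \<open>fp p > 1\<close> on \<open>[0,1)\<close>, which
  is \<open>(p - 2) * sinh (p * t) > p * sinh ((p - 2) * t)\<close> in disguise. Both inequalities say that
  \<open>sinh x / x\<close> increases for \<open>x > 0\<close> (lemma \<open>one_minus_powr_less\<close>).

  For \<open>s = -1\<close>, the difference of squares is \<open>gp p v\<close>. It decreases strictly on \<open>[0,1]\<close> from
  \<open>1\<close> to a negative value and so has exactly one root \<open>v\<close>. Hence \<open>fp p\<close> increases on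
  \<open>[-1,-v]\<close>, and it decreases from \<open>-v\<close> on, first to \<open>0\<close> and then to \<open>1\<close>. This unimodality gives
  quasiconcavity and the unique maximum, and the derivative formula identifies the stationary
  points in \<open>(-1,0)\<close> with the roots of \<open>gp p\<close>.

  For part (ii), fix \<open>u = - v\<close> and differentiate in the exponent. With \<open>w = v powr (p - 1)\<close>, the
  numerator of the derivative is
  \<open>(1 + v) * (1 + w) * (1 - v * w) - ln v * w * p * (p - 1) * (1 + v)\<^sup>2\<close>,
  and both summands are positive because \<open>v\<close> and \<open>w\<close> lie in \<open>(0,1)\<close>.
\<close>

section \<open>Numerator and denominator on the two half-lines\<close>

text \<open>
  These are the numerator and the denominator of \<open>fp p (s * u)\<close> for \<open>u \<ge> 0\<close> and a sign \<open>s\<close>, written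
  without absolute values. The sign stays a parameter so that the derivative is computed only once.
\<close>

definition fp_num :: "real \<Rightarrow> real \<Rightarrow> real \<Rightarrow> real" where
  "fp_num s p u = u powr p - s * p * u + (p - 1)"

definition fp_den :: "real \<Rightarrow> real \<Rightarrow> real \<Rightarrow> real" where
  "fp_den s p u = (p - 1) * u powr p - s * p * u powr (p - 1) + 1"

lemma fp_eq_pos:
  assumes "0 \<le> u" "u < 1"
  shows "fp p u = fp_num 1 p u / fp_den 1 p u"
  using assms by (cases "u = 0") (auto simp: fp_def fp_num_def fp_den_def)

lemma fp_eq_neg:
  assumes "u \<le> 0"
  shows "fp p u = fp_num (-1) p (-u) / fp_den (-1) p (-u)"
  using assms by (cases "u = 0") (auto simp: fp_def fp_num_def fp_den_def)

lemma powr_eq_mult_powr_minus_2: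
  fixes u :: real
  assumes "u > 0"
  shows "u powr (p - 1) = u * u powr (p - 2)" "u powr p = u\<^sup>2 * u powr (p - 2)"
    "u powr (2 * (p - 1)) = (u * u powr (p - 2))\<^sup>2"
proof -
  show 1: "u powr (p - 1) = u * u powr (p - 2)"
    using powr_add[of u 1 "p - 2"] assms by simp
  show "u powr p = u\<^sup>2 * u powr (p - 2)"
    using powr_add[of u 2 "p - 2"] assms by simp
  show "u powr (2 * (p - 1)) = (u * u powr (p - 2))\<^sup>2"
    using powr_powr[of u "p - 1" 2] assms by (simp add: 1 mult.commute)
qed

text \<open>
  Both squares contain the monomial \<open>u powr (p - 1)\<close>, and the coefficients match because
  \<open>2 * p * (p - 2) = 2 * (p - 1)\<^sup>2 - 2\<close>.
\<close>

lemma gp_eq_squares: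
  assumes "u > 0"
  shows "gp p u = (1 + u powr (p - 1))\<^sup>2 - (p - 1)\<^sup>2 * u powr (p - 2) * (1 + u)\<^sup>2"
  unfolding gp_def powr_eq_mult_powr_minus_2[OF assms, of p]
  by (simp add: power2_eq_square algebra_simps)

lemma continuous_on_powr_pos_exponent:
  fixes S :: "real set"
  assumes "a > 0" "\<And>u. u \<in> S \<Longrightarrow> u \<ge> 0"
  shows "continuous_on S (\<lambda>u. u powr a)"
  using assms by (intro continuous_on_powr' continuous_on_id continuous_on_const) auto

lemma continuous_on_gp:
  assumes "p > 2" "\<And>u. u \<in> S \<Longrightarrow> u \<ge> 0"
  shows "continuous_on S (gp p)"
  unfolding gp_def using assms
  by (intro continuous_on_add continuous_on_diff continuous_on_mult continuous_on_const
      continuous_on_powr_pos_exponent) auto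

lemma continuous_on_fp_num:
  assumes "p > 2" "\<And>u. u \<in> S \<Longrightarrow> u \<ge> 0"
  shows "continuous_on S (fp_num s p)"
  unfolding fp_num_def using assms
  by (intro continuous_on_add continuous_on_diff continuous_on_mult continuous_on_const
      continuous_on_id continuous_on_powr_pos_exponent) auto

lemma continuous_on_fp_den:
  assumes "p > 2" "\<And>u. u \<in> S \<Longrightarrow> u \<ge> 0"
  shows "continuous_on S (fp_den s p)"
  unfolding fp_den_def using assms
  by (intro continuous_on_add continuous_on_diff continuous_on_mult continuous_on_const
      continuous_on_powr_pos_exponent) auto

lemma fp_den_neg_pos:
  assumes "p > 2" "u \<ge> 0"
  shows "fp_den (-1) p u > 0"
proof -
  have "(p - 1) * u powr p \<ge> 0" "p * u powr (p - 1) \<ge> 0" using assms by auto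
  then show ?thesis unfolding fp_den_def by simp
qed

lemma fp_den_has_derivative:
  assumes "u > 0"
  shows "(fp_den s p has_real_derivative p * (p - 1) * u powr (p - 2) * (u - s)) (at u)"
proof -
  have "(fp_den s p has_real_derivative
      ((p - 1) * (p * u powr (p - 1)) - s * p * ((p - 1) * u powr (p - 1 - 1)))) (at u)"
    unfolding fp_den_def using assms by (auto intro!: derivative_eq_intros)
  then show ?thesis
    by (rule DERIV_cong) (simp add: powr_eq_mult_powr_minus_2[OF assms, of p] algebra_simps)
qed

text \<open>
  The derivative has the sign of \<open>u - 1\<close>, and the denominator vanishes at \<open>1\<close>.
\<close>

lemma fp_den_pos_pos:
  assumes "p > 2" "0 \<le> u" "u < 1"
  shows "fp_den 1 p u > 0"
proof (cases "u = 0")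
  case True
  then show ?thesis by (simp add: fp_den_def)
next
  case False
  with assms have "u > 0" by simp
  have "fp_den 1 p u > fp_den 1 p 1"
  proof (rule DERIV_neg_imp_decreasing_open[OF \<open>u < 1\<close>])
    fix x assume "u < x" "x < 1"
    with assms have x: "0 < x" "x < 1" by auto
    have "p * (p - 1) * x powr (p - 2) * (x - 1) < 0"
      using assms x by (intro mult_pos_neg) auto
    with fp_den_has_derivative[OF x(1), of 1 p]
    show "\<exists>d. (fp_den 1 p has_real_derivative d) (at x) \<and> d < 0" by blast
  next
    show "continuous_on {u..1} (fp_den 1 p)"
      using assms by (intro continuous_on_fp_den) auto
  qed
  then show ?thesis by (simp add: fp_den_def)
qed

section \<open>The derivative of the quotient\<close>

text \<open>
  The factorisation of the numerator in the quotient rule is a polynomial identity in \<open>u\<close> and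
  \<open>w = u powr (p - 2)\<close> modulo \<open>s\<^sup>2 = 1\<close>. As a difference of two squares, its sign is decided by
  comparing two square roots.
\<close>

lemma ratio_has_derivative:
  assumes "s\<^sup>2 = 1" "u > 0" "fp_den s p u \<noteq> 0"
  shows "((\<lambda>u. fp_num s p u / fp_den s p u) has_real_derivative
     - s * p * ((1 - s * u powr (p - 1))\<^sup>2 - (p - 1)\<^sup>2 * u powr (p - 2) * (1 - s * u)\<^sup>2)
       / (fp_den s p u)\<^sup>2) (at u)"
proof -
  define w where "w = u powr (p - 2)"
  note pw = powr_eq_mult_powr_minus_2[OF assms(2), of p, folded w_def]
  have num: "(fp_num s p has_real_derivative (p * u powr (p - 1) - s * p)) (at u)"
    unfolding fp_num_def using assms by (auto intro!: derivative_eq_intros)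
  note den = fp_den_has_derivative[OF assms(2), of s p]
  have s: "s = 1 \<or> s = -1" using assms(1) by (simp add: power2_eq_1_iff)
  have "(p * (u * w) - s * p) * ((p - 1) * (u\<^sup>2 * w) - s * p * (u * w) + 1)
      - (u\<^sup>2 * w - s * p * u + (p - 1)) * (p * (p - 1) * w * (u - s))
     = - s * p * ((1 - s * (u * w))\<^sup>2 - (p - 1)\<^sup>2 * w * (1 - s * u)\<^sup>2)"
    using s by (elim disjE) (simp_all add: power2_eq_square algebra_simps)
  then have "(p * u powr (p - 1) - s * p) * fp_den s p u
      - fp_num s p u * (p * (p - 1) * u powr (p - 2) * (u - s))
     = - s * p * ((1 - s * u powr (p - 1))\<^sup>2 - (p - 1)\<^sup>2 * u powr (p - 2) * (1 - s * u)\<^sup>2)"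
    unfolding fp_den_def fp_num_def pw w_def[symmetric] .
  then show ?thesis
    using DERIV_divide[OF num den assms(3)] by (simp add: power2_eq_square)
qed

lemma continuous_on_ratio:
  assumes "p > 2" "\<And>u. u \<in> S \<Longrightarrow> u \<ge> 0" "\<And>u. u \<in> S \<Longrightarrow> fp_den s p u \<noteq> 0"
  shows "continuous_on S (\<lambda>u. fp_num s p u / fp_den s p u)"
  using assms by (intro continuous_on_divide continuous_on_fp_num continuous_on_fp_den) auto

section \<open>Decrease on the positive half\<close>

text \<open>
  This is the monotonicity of \<open>sinh x / x\<close>. The difference of the two sides vanishes at \<open>t = 0\<close> and
  has derivative \<open>a * b * (cosh (b * t) - cosh (a * t))\<close>.
\<close>

lemma sinh_mult_less:
  fixes a b t :: real
  assumes "0 < a" "a < b" "t > 0"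
  shows "b * sinh (a * t) < a * sinh (b * t)"
proof -
  have "(\<lambda>t. a * sinh (b * t) - b * sinh (a * t)) 0 < (\<lambda>t. a * sinh (b * t) - b * sinh (a * t)) t"
  proof (rule DERIV_pos_imp_increasing_open[OF \<open>t > 0\<close>])
    fix x :: real assume x: "0 < x" "x < t"
    have "cosh (a * x) < cosh (b * x)"
      using assms x by (subst cosh_real_nonneg_less_iff) auto
    then have "a * b * (cosh (b * x) - cosh (a * x)) > 0" using assms by simp
    moreover have "((\<lambda>t. a * sinh (b * t) - b * sinh (a * t)) has_real_derivative
        a * b * (cosh (b * x) - cosh (a * x))) (at x)"
      by (auto intro!: derivative_eq_intros simp: algebra_simps)
    ultimately show "\<exists>y. ((\<lambda>t. a * sinh (b * t) - b * sinh (a * t)) has_real_derivative y) (at x) \<and> y > 0"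
      by blast
  qed (intro continuous_intros)
  then show ?thesis by simp
qed

text \<open>
  With \<open>u = exp (- 2 * t)\<close>, one has \<open>1 - u powr c = 2 * u powr (c / 2) * sinh (c * t)\<close>; after division
  by \<open>2 * u powr (b / 2)\<close>, the claim is the inequality for \<open>sinh\<close>.
\<close>

lemma one_minus_powr_less:
  fixes a b u :: real
  assumes "0 < a" "a < b" "0 < u" "u < 1"
  shows "b * u powr ((b - a) / 2) * (1 - u powr a) < a * (1 - u powr b)"
proof -
  define t where "t = - ln u / 2"
  have t: "t > 0" using assms by (simp add: t_def)
  have *: "1 - u powr c = 2 * u powr (c / 2) * sinh (c * t)" for c
  proof -
    have "u powr (c / 2) = exp (- (c * t))"
      using assms by (simp add: powr_def t_def)
    moreover have "u powr c = exp (- (c * t)) * exp (- (c * t))"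
      using assms by (simp add: powr_def t_def flip: exp_add)
    ultimately show ?thesis
      by (simp add: sinh_field_def algebra_simps flip: exp_add)
  qed
  have "b * u powr ((b - a) / 2) * (1 - u powr a)
      = 2 * (u powr ((b - a) / 2) * u powr (a / 2)) * (b * sinh (a * t))"
    by (simp add: *)
  also have "u powr ((b - a) / 2) * u powr (a / 2) = u powr (b / 2)"
    by (simp add: diff_divide_distrib flip: powr_add)
  also have "2 * u powr (b / 2) * (b * sinh (a * t)) < 2 * u powr (b / 2) * (a * sinh (b * t))"
    using sinh_mult_less[OF assms(1,2) t] assms by simp
  also have "\<dots> = a * (1 - u powr b)" by (simp add: *)
  finally show ?thesis .
qed

lemma fp_decreasing_on_unit_interval:
  assumes "p > 2" "0 \<le> x" "x < y" "y < 1"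
  shows "fp p y < fp p x"
proof -
  let ?r = "\<lambda>u. fp_num 1 p u / fp_den 1 p u"
  have "?r y < ?r x"
  proof (rule DERIV_neg_imp_decreasing_open[OF \<open>x < y\<close>])
    fix u assume u: "x < u" "u < y"
    then have u01: "0 < u" "u < 1" using assms by auto
    have D: "fp_den 1 p u > 0" using fp_den_pos_pos assms u01 by simp
    \<comment> \<open>the inequality between the square roots of the two squares in the derivative\<close>
    have "(p - 1) * u powr ((p - 2) / 2) * (1 - u) < 1 - u powr (p - 1)"
      using one_minus_powr_less[of 1 "p - 1" u] assms u01 by simp
    moreover have "(p - 1) * u powr ((p - 2) / 2) * (1 - u) \<ge> 0"
      using assms u01 by simp
    ultimately have "((p - 1) * u powr ((p - 2) / 2) * (1 - u))\<^sup>2 < (1 - u powr (p - 1))\<^sup>2"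
      by (intro power_strict_mono) auto
    moreover have "(u powr ((p - 2) / 2))\<^sup>2 = u powr (p - 2)"
      using u01 by (simp add: power2_eq_square flip: powr_add)
    ultimately have "(1 - u powr (p - 1))\<^sup>2 - (p - 1)\<^sup>2 * u powr (p - 2) * (1 - u)\<^sup>2 > 0"
      by (simp add: power_mult_distrib)
    then have "- 1 * p * ((1 - 1 * u powr (p - 1))\<^sup>2 - (p - 1)\<^sup>2 * u powr (p - 2) * (1 - 1 * u)\<^sup>2)
       / (fp_den 1 p u)\<^sup>2 < 0"
      using D assms by (intro divide_neg_pos) auto
    with ratio_has_derivative[of 1 u p] D u01
    show "\<exists>d. (?r has_real_derivative d) (at u) \<and> d < 0" by auto
  next
    have "fp_den 1 p u \<noteq> 0" if "u \<in> {x..y}" for u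
      using fp_den_pos_pos[of p u] that assms by auto
    then show "continuous_on {x..y} ?r"
      using assms by (intro continuous_on_ratio) auto
  qed
  then show ?thesis using assms by (simp add: fp_eq_pos)
qed

text \<open>
  Numerator minus denominator equals \<open>(p - 2) * (1 - u powr p) - p * u * (1 - u powr (p - 2))\<close>.
\<close>

lemma fp_gt_1:
  assumes "p > 2" "0 \<le> u" "u < 1"
  shows "fp p u > 1"
proof (cases "u = 0")
  case True
  with assms show ?thesis by (simp add: fp_def)
next
  case False
  with assms have u: "u > 0" by simp
  have "p * u * (1 - u powr (p - 2)) < (p - 2) * (1 - u powr p)"
    using one_minus_powr_less[of "p - 2" p u] assms u by simp
  then have "fp_den 1 p u < fp_num 1 p u"
    unfolding fp_num_def fp_den_def powr_eq_mult_powr_minus_2[OF u, of p]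
    by (simp add: algebra_simps)
  then show ?thesis
    using fp_den_pos_pos[OF assms] assms by (simp add: fp_eq_pos)
qed

lemma fp_strict_antimono_nonneg:
  assumes "p > 2" "0 \<le> x" "x < y" "y \<le> 1"
  shows "fp p y < fp p x"
  using assms fp_decreasing_on_unit_interval[of p x y] fp_gt_1[of p x]
  by (cases "y = 1") (auto simp: fp_def)

section \<open>The root of \<open>gp\<close>\<close>

text \<open>
  Only the first term of \<open>gp p\<close> increases. Its derivative is at most \<open>2 * (p - 1) * u powr (p - 1)\<close>,
  since \<open>2 * p - 3 \<ge> p - 1\<close> and \<open>u \<le> 1\<close>, and the derivative of the second term outweighs this
  because \<open>p * (p - 1) > 2\<close>.
\<close>

lemma gp_strict_antimono:
  assumes "p > 2" "0 \<le> x" "x < y" "y \<le> 1"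
  shows "gp p y < gp p x"
proof (rule DERIV_neg_imp_decreasing_open[OF \<open>x < y\<close>])
  fix u assume u: "x < u" "u < y"
  then have u01: "0 < u" "u < 1" using assms by auto
  define d where "d = 2 * (p - 1) * u powr (2 * (p - 1) - 1) - (p - 1)\<^sup>2 * (p * u powr (p - 1))
      - 2 * p * (p - 2) * ((p - 1) * u powr (p - 1 - 1)) - (p - 1)\<^sup>2 * ((p - 2) * u powr (p - 2 - 1))"
  have "(gp p has_real_derivative d) (at u)"
    unfolding gp_def d_def using u01 by (auto intro!: derivative_eq_intros)
  moreover have "d < 0"
  proof -
    have "u powr (2 * (p - 1) - 1) \<le> u powr (p - 1)"
      using u01 assms by (intro powr_mono') auto
    then have "2 * (p - 1) * u powr (2 * (p - 1) - 1) \<le> 2 * (p - 1) * u powr (p - 1)"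
      using assms by (intro mult_left_mono) auto
    also have "\<dots> < (p - 1)\<^sup>2 * p * u powr (p - 1)"
    proof -
      have "1 * 2 < (p - 1) * p" using assms by (intro mult_strict_mono) auto
      then have "(p - 1) * 2 < (p - 1) * ((p - 1) * p)"
        using assms by (intro mult_strict_left_mono) auto
      then have "2 * (p - 1) < (p - 1)\<^sup>2 * p"
        by (simp only: power2_eq_square mult_ac)
      then show ?thesis using u01 by (intro mult_strict_right_mono) auto
    qed
    finally have "2 * (p - 1) * u powr (2 * (p - 1) - 1) < (p - 1)\<^sup>2 * (p * u powr (p - 1))"
      by (simp add: mult.assoc)
    moreover have "2 * p * (p - 2) * ((p - 1) * u powr (p - 1 - 1)) \<ge> 0"
      "(p - 1)\<^sup>2 * ((p - 2) * u powr (p - 2 - 1)) \<ge> 0" using assms by auto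
    ultimately show ?thesis unfolding d_def by linarith
  qed
  ultimately show "\<exists>d. (gp p has_real_derivative d) (at u) \<and> d < 0" by blast
next
  show "continuous_on {x..y} (gp p)"
    using assms by (intro continuous_on_gp) auto
qed

lemma gp_root_exists:
  assumes "p > 2"
  obtains v where "0 < v" "v < 1" "gp p v = 0"
proof -
  have 0: "gp p 0 = 1" by (simp add: gp_def)
  have "gp p 1 = 4 * (1 - (p - 1)\<^sup>2)" by (simp add: gp_def power2_eq_square algebra_simps)
  moreover have "(p - 1)\<^sup>2 > 1" using assms by (simp add: one_less_power)
  ultimately have 1: "gp p 1 < 0" by simp
  have "continuous_on {0..1} (gp p)"
    using assms by (intro continuous_on_gp) auto
  with 0 1 IVT2'[of "gp p" 1 0 0] obtain v where "0 \<le> v" "v \<le> 1" "gp p v = 0" by auto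
  with 0 1 that[of v] show ?thesis by (cases "v = 0"; cases "v = 1") auto
qed

section \<open>The negative half\<close>

lemma reflected_ratio_has_derivative:
  assumes "p > 2" "v > 0"
  shows "((\<lambda>u. fp_num (-1) p u / fp_den (-1) p u) has_real_derivative
    p * gp p v / (fp_den (-1) p v)\<^sup>2) (at v)"
  using ratio_has_derivative[of "-1" v p] fp_den_neg_pos[of p v] assms
  by (simp add: gp_eq_squares)

lemma fp_has_derivative_neg:
  assumes "p > 2" "u < 0"
  shows "(fp p has_real_derivative - (p * gp p (-u) / (fp_den (-1) p (-u))\<^sup>2)) (at u)"
proof -
  let ?r = "\<lambda>u. fp_num (-1) p u / fp_den (-1) p u"
  have "((\<lambda>x. ?r (- x)) has_real_derivative - (p * gp p (-u) / (fp_den (-1) p (-u))\<^sup>2)) (at u)"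
    using reflected_ratio_has_derivative[of p "-u"] assms by (intro DERIV_mirror[THEN iffD1]) simp_all
  moreover have "\<forall>\<^sub>F x in nhds u. x < 0"
    using assms by (intro order_tendstoD[OF filterlim_ident]) auto
  then have "\<forall>\<^sub>F x in nhds u. ?r (- x) = fp p x"
    by eventually_elim (simp add: fp_eq_neg)
  ultimately show ?thesis
    by (subst DERIV_cong_ev[OF refl _ refl, of "fp p" "\<lambda>x. ?r (- x)"]) (auto elim: eventually_mono)
qed

lemma continuous_on_fp_nonpos:
  assumes "p > 2"
  shows "continuous_on {..0} (fp p)"
proof -
  let ?r = "\<lambda>u. fp_num (-1) p u / fp_den (-1) p u"
  have "continuous_on {0..} ?r"
    using assms fp_den_neg_pos by (intro continuous_on_ratio) force+
  then have "continuous_on {..0} (\<lambda>x. ?r (- x))"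
    by (rule continuous_on_compose2) (auto intro!: continuous_intros)
  then show ?thesis
    by (rule continuous_on_cong[THEN iffD1, rotated -1]) (auto simp: fp_eq_neg)
qed

section \<open>Monotonicity in the exponent\<close>

text \<open>
  The quotient is differentiated in \<open>p\<close>. In the numerator of the quotient rule, the terms without
  \<open>ln v\<close> and the coefficient of \<open>ln v\<close> factor separately, and each part contributes a positive
  amount.
\<close>

lemma fp_strict_mono_in_exponent:
  assumes "2 < p" "p < q" "-1 < u" "u < 0"
  shows "fp p u < fp q u"
proof -
  define v where "v = - u"
  have v: "0 < v" "v < 1" using assms by (auto simp: v_def)
  let ?r = "\<lambda>p. fp_num (-1) p v / fp_den (-1) p v"
  have "?r p < ?r q"
  proof (rule DERIV_pos_imp_increasing[OF \<open>p < q\<close>])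
    fix x assume x: "p \<le> x" "x \<le> q"
    then have x2: "x > 2" using assms by simp
    define w where "w = v powr (x - 1)"
    have vw: "v powr x = v * w" using powr_add[of v 1 "x - 1"] v by (simp add: w_def)
    have w: "0 < w" using v by (simp add: w_def)
    have "w \<le> 1" using v x2 by (simp add: w_def powr_le1)
    then have vw1: "v * w < 1" using v mult_left_le[of w v] by linarith
    have L: "ln v < 0" using v by simp
    have D: "fp_den (-1) x v > 0" using fp_den_neg_pos x2 v by simp
    have num: "((\<lambda>p. fp_num (-1) p v) has_real_derivative v * w * ln v + (1 + v)) (at x)"
      unfolding fp_num_def using v by (auto intro!: derivative_eq_intros simp: vw)
    have den: "((\<lambda>p. fp_den (-1) p v) has_real_derivative
       w * (1 + v) + ln v * (x * w * (1 + v) - v * w)) (at x)"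
      unfolding fp_den_def using v
      by (auto intro!: derivative_eq_intros simp: vw w_def[symmetric] algebra_simps)
    let ?n = "(v * w * ln v + (1 + v)) * fp_den (-1) x v
      - fp_num (-1) x v * (w * (1 + v) + ln v * (x * w * (1 + v) - v * w))"
    have "?n = (1 + v) * (1 + w) * (1 - v * w) + (- ln v) * (w * x * (x - 1) * (1 + v)\<^sup>2)"
      unfolding fp_num_def fp_den_def vw w_def[symmetric]
      by (simp add: power2_eq_square algebra_simps)
    also have "\<dots> > 0"
      using v w vw1 L x2 by (intro add_pos_pos mult_pos_pos) auto
    finally have "?n / (fp_den (-1) x v * fp_den (-1) x v) > 0"
      using D by simp
    with DERIV_divide[OF num den] D
    show "\<exists>d. (?r has_real_derivative d) (at x) \<and> d > 0" by auto
  qed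
  then show ?thesis using assms by (simp add: fp_eq_neg v_def)
qed

section \<open>Unimodality and the conclusion\<close>

lemma quasiconcave_on_if_unimodal:
  fixes f :: "real \<Rightarrow> real"
  assumes up: "\<And>x y. a \<le> x \<Longrightarrow> x \<le> y \<Longrightarrow> y \<le> c \<Longrightarrow> f x \<le> f y"
    and down: "\<And>x y. c \<le> x \<Longrightarrow> x \<le> y \<Longrightarrow> y \<le> b \<Longrightarrow> f y \<le> f x"
  shows "quasiconcave_on {a..b} f"
proof -
  have between: "min (f x) (f y) \<le> f z" if "a \<le> x" "x \<le> z" "z \<le> y" "y \<le> b" for x y z
    using up[of x z] down[of z y] that by (cases "z \<le> c") (auto simp: min_le_iff_disj)
  show ?thesis
    unfolding quasiconcave_on_def
  proof (intro conjI ballI)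
    fix x y t :: real
    assume xy: "x \<in> {a..b}" "y \<in> {a..b}" "t \<in> {0..1}"
    have "(1 - t) *\<^sub>R x + t *\<^sub>R y \<in> closed_segment x y"
      using xy by (auto simp: closed_segment_def)
    then have "(x \<le> (1 - t) *\<^sub>R x + t *\<^sub>R y \<and> (1 - t) *\<^sub>R x + t *\<^sub>R y \<le> y) \<or>
        (y \<le> (1 - t) *\<^sub>R x + t *\<^sub>R y \<and> (1 - t) *\<^sub>R x + t *\<^sub>R y \<le> x)"
      by (auto simp: closed_segment_eq_real_ivl split: if_splits)
    then show "min (f x) (f y) \<le> f ((1 - t) *\<^sub>R x + t *\<^sub>R y)"
      using between[of x _ y] between[of y _ x] xy by (auto simp: min.commute)
  qed simp
qed

theorem proposition4p2:
  fixes p :: real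
  assumes "p > 2"
  shows "quasiconcave_on {-1..1} (fp p) \<and>
         (\<exists>u\<^sub>0\<in>{-1<..<0}.
            {u. is_arg_max (fp p) (\<lambda>v. v \<in> {-1..1}) u} = {u\<^sub>0} \<and>
            {u \<in> {-1<..<0}. stationary_point (fp p) u} = {u\<^sub>0} \<and>
            {u \<in> {0..1}. gp p u = 0} = {- u\<^sub>0}) \<and>
         (\<forall>q>p. \<forall>u\<in>{-1<..<0}. fp q u > fp p u)"
proof -
  obtain v where v: "0 < v" "v < 1" "gp p v = 0"
    using gp_root_exists[OF assms] .
  have gp_neg: "gp p u < 0" if "v < u" "u \<le> 1" for u
    using gp_strict_antimono[of p v u] assms v that by simp
  have gp_pos: "gp p u > 0" if "0 \<le> u" "u < v" for u
    using gp_strict_antimono[of p u v] assms v that by simp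
  have den: "(fp_den (-1) p (-u))\<^sup>2 > 0" if "u < 0" for u
    using fp_den_neg_pos[of p "-u"] assms that by simp
  \<comment> \<open>the point \<open>-v\<close> is the peak\<close>
  have up: "fp p x < fp p y" if "-1 \<le> x" "x < y" "y \<le> -v" for x y
  proof (rule DERIV_pos_imp_increasing_open[OF \<open>x < y\<close>])
    fix u assume u: "x < u" "u < y"
    then have "- (p * gp p (-u) / (fp_den (-1) p (-u))\<^sup>2) > 0"
      using den[of u] gp_neg[of "-u"] that v assms
      by (auto simp: divide_less_0_iff mult_less_0_iff)
    then show "\<exists>d. (fp p has_real_derivative d) (at u) \<and> d > 0"
      using fp_has_derivative_neg[of p u] assms that u v by auto
  next
    show "continuous_on {x..y} (fp p)"
      using continuous_on_subset[OF continuous_on_fp_nonpos[OF assms], of "{x..y}"] that v by auto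
  qed
  have down_neg: "fp p y < fp p x" if "-v \<le> x" "x < y" "y \<le> 0" for x y
  proof (rule DERIV_neg_imp_decreasing_open[OF \<open>x < y\<close>])
    fix u assume u: "x < u" "u < y"
    then have "- (p * gp p (-u) / (fp_den (-1) p (-u))\<^sup>2) < 0"
      using den[of u] gp_pos[of "-u"] that v assms
      by (auto simp: zero_less_divide_iff zero_less_mult_iff)
    then show "\<exists>d. (fp p has_real_derivative d) (at u) \<and> d < 0"
      using fp_has_derivative_neg[of p u] assms that u v by auto
  next
    show "continuous_on {x..y} (fp p)"
      using continuous_on_subset[OF continuous_on_fp_nonpos[OF assms], of "{x..y}"] that v by auto
  qed
  have down: "fp p y < fp p x" if "-v \<le> x" "x < y" "y \<le> 1" for x y
    using down_neg[of x y] down_neg[of x 0] fp_strict_antimono_nonneg[OF assms, of x y]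
      fp_strict_antimono_nonneg[OF assms, of 0 y] that
    by (cases "y \<le> 0"; cases "x < 0") auto
  have "quasiconcave_on {-1..1} (fp p)"
    using up down by (intro quasiconcave_on_if_unimodal[of _ "-v"]) (auto simp: le_less)
  moreover have max: "fp p u < fp p (-v)" if "u \<in> {-1..1}" "u \<noteq> -v" for u
    using up[of u "-v"] down[of "-v" u] that v by (cases "u < -v") auto
  have "is_arg_max (fp p) (\<lambda>v. v \<in> {-1..1}) u \<longleftrightarrow> u = -v" for u
  proof
    assume "is_arg_max (fp p) (\<lambda>v. v \<in> {-1..1}) u"
    then have "u \<in> {-1..1}" "\<not> fp p u < fp p (-v)"
      using v by (auto simp: is_arg_max_def)
    with max show "u = -v" by blast
  next
    assume "u = -v"
    moreover have "\<not> fp p (-v) < fp p y" if "y \<in> {-1..1}" for y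
      using max[OF that] by (cases "y = -v") auto
    ultimately show "is_arg_max (fp p) (\<lambda>v. v \<in> {-1..1}) u"
      using v by (auto simp: is_arg_max_def)
  qed
  then have "{u. is_arg_max (fp p) (\<lambda>v. v \<in> {-1..1}) u} = {-v}" by blast
  moreover have "{u \<in> {-1<..<0}. stationary_point (fp p) u} = {-v}"
  proof -
    have "stationary_point (fp p) u \<longleftrightarrow> gp p (-u) = 0" if "u < 0" for u
      unfolding stationary_point_def
      using fp_has_derivative_neg[OF assms that] den[OF that] assms
      by (auto dest: DERIV_unique)
    moreover have "gp p (-u) = 0 \<longleftrightarrow> u = -v" if "-1 < u" "u < 0" for u
      using gp_neg[of "-u"] gp_pos[of "-u"] v that by (cases "-u" v rule: linorder_cases) auto
    ultimately show ?thesis using v by auto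
  qed
  moreover have "{u \<in> {0..1}. gp p u = 0} = {- (- v)}"
    using gp_neg gp_pos v by (auto, metis linorder_neqE less_irrefl)
  moreover have "\<forall>q>p. \<forall>u\<in>{-1<..<0}. fp q u > fp p u"
    using fp_strict_mono_in_exponent assms by auto
  ultimately show ?thesis using v by (intro conjI bexI[of _ "-v"]) auto
qed

end
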